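(* Let $\mathcal{H}=(V,E)$ be a $k$-uniform hypergraph, let $I(\mathcal{H}) = (x_{a_1}\cdots x_{a_k} \mid \{a_1,\ldots,a_k\}\in E(\mathcal{H}))$ be its edge ideal, and let $\mathcal{L}(I(\mathcal{H}))$ be the lcm-lattice of $I(\mathcal{H})$. Then the following are equivalent: (a) $\mathcal{L}(I(\mathcal{H}))$ is isomorphic to a Boolean lattice; (b) every hyperedge $e\in E(\mathcal{H})$ contains at least one vertex $v_e\in e$ such that $v_e\notin e'$ for all other hyperedges $e'\in E(\mathcal{H})\setminus\{e\}$.
   Context: A $k$-uniform hypergraph $\mathcal{H}=(V,E)$ consists of a vertex set $V=\{1,\dots,n\}$ and a set $E=E(\mathcal{H})$ of $k$-element subsets of $V$ (the hyperedges). Its edge ideal $I(\mathcal{H})$ is the ideal of $S=\mathbb{K}[x_1,\dots,x_n]$ ($\mathbb{K}$ a field) generated by the square-free monomials $x_{i_1}\cdots x_{i_k}$ for $\{i_1,\dots,i_k\}\in E$. The lcm-lattice $\mathcal{L}(I)$ of a monomial ideal $I$ is the set of all least common multiples of subsets of the set of minimal monomial generators of $I$, partially ordered by divisibility; the empty subset contributes the minimal element $\hat 0 = 1$, and the maximal element $\hat 1$ is the lcm of all generators. The Boolean lattice of rank $r$ is the set of all subsets of $\{1,\dots,r\}$ ordered by inclusion; "isomorphic to a Boolean lattice" means isomorphic, as a lattice, to the Boolean lattice of rank $r$ for some $r$. *)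

theory Defs
  imports
    "HOL-Library.Poly_Mapping"
    "HOL-Algebra.Ideal"
    "HOL-Algebra.Divisibility"
begin

section \<open>The polynomial ring\<close>

text \<open>
  Exponent vectors are finitely supported functions \<open>nat \<Rightarrow>\<^sub>0 nat\<close>, so \<open>'k mpoly\<close> is the monoid
  algebra of polynomials over \<open>'k\<close> in countably many variables. The ring \<open>K[x_1,\<dots>,x_n]\<close> is the
  subring of those polynomials in which only variables with index in \<open>{1..n}\<close> occur.
\<close>

type_synonym 'k mpoly = "(nat \<Rightarrow>\<^sub>0 nat) \<Rightarrow>\<^sub>0 'k"

definition poly_ring :: "nat \<Rightarrow> ('k::field) mpoly ring" where
  "poly_ring n =
     \<lparr>carrier = {p. \<forall>a\<in>Poly_Mapping.keys p. Poly_Mapping.keys a \<subseteq> {1..n}},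
      monoid.mult = (*), one = 1, zero = 0, add = (+)\<rparr>"

definition var :: "nat \<Rightarrow> ('k::field) mpoly" where
  "var i = Poly_Mapping.single (Poly_Mapping.single i 1) 1"

definition monomials :: "nat \<Rightarrow> ('k::field) mpoly set" where
  "monomials n = {Poly_Mapping.single a 1 | a. Poly_Mapping.keys a \<subseteq> {1..n}}"

lemma poly_ring_cring: "cring (poly_ring n :: ('k::field) mpoly ring)"
proof (rule cringI)
  show "abelian_group (poly_ring n :: 'k mpoly ring)"
  proof (rule abelian_groupI)
    fix x :: "'k mpoly" assume x: "x \<in> carrier (poly_ring n)"
    show "\<exists>y\<in>carrier (poly_ring n). y \<oplus>\<^bsub>poly_ring n\<^esub> x = \<zero>\<^bsub>poly_ring n\<^esub>"
      by (rule bexI[of _ "- x"]) (use x in \<open>auto simp: poly_ring_def in_keys_iff\<close>)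
  qed (use keys_add in \<open>fastforce simp: poly_ring_def add_ac\<close>)+
  show "Group.comm_monoid (poly_ring n :: 'k mpoly ring)"
  proof (rule comm_monoidI)
    fix x y :: "'k mpoly"
    assume xy: "x \<in> carrier (poly_ring n)" "y \<in> carrier (poly_ring n)"
    have "Poly_Mapping.keys c \<subseteq> {1..n}" if c: "c \<in> Poly_Mapping.keys (x * y)" for c
    proof -
      obtain a b where "a \<in> Poly_Mapping.keys x" "b \<in> Poly_Mapping.keys y" "c = a + b"
        using keys_mult[of x y] c by blast
      with xy keys_add[of a b] show ?thesis
        by (fastforce simp: poly_ring_def)
    qed
    then show "x \<otimes>\<^bsub>poly_ring n\<^esub> y \<in> carrier (poly_ring n)"
      by (simp add: poly_ring_def)
  qed (auto simp: poly_ring_def mult_ac)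
qed (simp add: poly_ring_def algebra_simps)


section \<open>Hypergraphs and edge ideals\<close>

definition uniform_hypergraph :: "nat \<Rightarrow> nat \<Rightarrow> nat set set \<Rightarrow> bool" where
  "uniform_hypergraph k n E \<longleftrightarrow> (\<forall>e\<in>E. e \<subseteq> {1..n} \<and> card e = k)"

definition edge_ideal :: "nat \<Rightarrow> nat set set \<Rightarrow> ('k::field) mpoly set" where
  "edge_ideal n E = Idl\<^bsub>poly_ring n\<^esub> ((\<lambda>e. \<Prod>i\<in>e. var i) ` E)"


section \<open>The lcm-lattice\<close>

definition is_min_mono_gens :: "nat \<Rightarrow> ('k::field) mpoly set \<Rightarrow> 'k mpoly set \<Rightarrow> bool" where
  "is_min_mono_gens n I G \<longleftrightarrow>
     G \<subseteq> monomials n \<and> Idl\<^bsub>poly_ring n\<^esub> G = I \<and> (\<forall>G'. G' \<subset> G \<longrightarrow> Idl\<^bsub>poly_ring n\<^esub> G' \<noteq> I)"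

text \<open>
  Every monomial ideal has exactly one minimal set of monomial generators (the monomials being
  normalised to have coefficient 1), so the description below is proper for monomial ideals.
\<close>

definition min_mono_gens :: "nat \<Rightarrow> ('k::field) mpoly set \<Rightarrow> 'k mpoly set" where
  "min_mono_gens n I = (THE G. is_min_mono_gens n I G)"

text \<open>
  A least common multiple in the ring is only determined up to units; the lcm-lattice takes the
  representative that is a monomial.
\<close>

definition is_lcm :: "('a, 'b) monoid_scheme \<Rightarrow> 'a set \<Rightarrow> 'a \<Rightarrow> bool" where
  "is_lcm R A m \<longleftrightarrow> m \<in> carrier R \<and> (\<forall>a\<in>A. a divides\<^bsub>R\<^esub> m) \<and>
     (\<forall>c\<in>carrier R. (\<forall>a\<in>A. a divides\<^bsub>R\<^esub> c) \<longrightarrow> m divides\<^bsub>R\<^esub> c)"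

definition lcm_lattice :: "nat \<Rightarrow> ('k::field) mpoly set \<Rightarrow> 'k mpoly gorder" where
  "lcm_lattice n I =
     \<lparr>carrier = {m \<in> monomials n. \<exists>A \<subseteq> min_mono_gens n I. is_lcm (poly_ring n) A m},
      eq = (=), le = (divides\<^bsub>poly_ring n\<^esub>)\<rparr>"


section \<open>Boolean lattices and lattice isomorphism\<close>

definition boolean_lattice :: "nat \<Rightarrow> nat set gorder" where
  "boolean_lattice r = \<lparr>carrier = Pow {1..r}, eq = (=), le = (\<subseteq>)\<rparr>"

definition lattice_isomorphic :: "('a, 'c) gorder_scheme \<Rightarrow> ('b, 'd) gorder_scheme \<Rightarrow> bool" where
  "lattice_isomorphic L M \<longleftrightarrow> Lattice.lattice L \<and> Lattice.lattice M \<and>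
     (\<exists>f. bij_betw f (carrier L) (carrier M) \<and>
        (\<forall>x\<in>carrier L. \<forall>y\<in>carrier L.
           f (x \<squnion>\<^bsub>L\<^esub> y) = f x \<squnion>\<^bsub>M\<^esub> f y \<and> f (x \<sqinter>\<^bsub>L\<^esub> y) = f x \<sqinter>\<^bsub>M\<^esub> f y))"

end

theory Submission
  imports Defs
begin

text \<open>
  Only unions of edges matter. The edges have a common size, so none properly contains another,
  and the products \<open>\<Prod>i\<in>e. x_i\<close> are pairwise incomparable under divisibility. Incomparable
  monomials are the minimal generators of the ideal that they generate
  (\<open>min_mono_gens_antichain\<close>), and the least common multiple of square-free monomials is the
  square-free monomial of the union of their supports (\<open>is_lcm_sqfree_Union\<close>). So the
  lcm-lattice is the family of unions \<open>\<Union>A\<close> with \<open>A \<subseteq> E\<close>, ordered by inclusion. Lattice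
  isomorphisms onto a power set are the same as order isomorphisms
  (\<open>lattice_isomorphic_boolean_iff\<close>), which leaves a question about this ordered family.

  If each edge has a vertex of its own, then a union \<open>\<Union>A\<close> contains no edge outside \<open>A\<close>, so \<open>A\<close>
  can be recovered from \<open>\<Union>A\<close>, and the unions are ordered like the subsets of \<open>E\<close>
  (\<open>private_vertex_imp_union_lattice_Boolean\<close>).

  Conversely, the edges are nonempty and incomparable, hence the atoms among the unions,
  so an order isomorphism onto a power set sends an edge \<open>e\<close> to a singleton \<open>{i}\<close>, and every other edge to a set without \<open>i\<close>. Hence the
  union that corresponds to the complement of \<open>{i}\<close> contains all the other edges but not \<open>e\<close>, so
  the other edges do not cover \<open>e\<close> (\<open>union_lattice_Boolean_imp_private_vertex\<close>).
\<close>

section \<open>Divisibility by monomials\<close>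

text \<open>
  The order on exponent vectors that corresponds to divisibility of monomials is the pointwise one,
  whereas \<open>\<le>\<close> on finitely supported functions is lexicographic.
\<close>
definition exp_le :: "(nat \<Rightarrow>\<^sub>0 nat) \<Rightarrow> (nat \<Rightarrow>\<^sub>0 nat) \<Rightarrow> bool" where
  "exp_le a b \<longleftrightarrow> (\<forall>i. Poly_Mapping.lookup a i \<le> Poly_Mapping.lookup b i)"

lemma exp_le_refl [simp]: "exp_le a a"
  by (simp add: exp_le_def)

lemma exp_le_trans: "exp_le a b \<Longrightarrow> exp_le b c \<Longrightarrow> exp_le a c"
  unfolding exp_le_def using le_trans by blast

lemma exp_le_antisym: "exp_le a b \<Longrightarrow> exp_le b a \<Longrightarrow> a = b"
  unfolding exp_le_def by (intro poly_mapping_eqI) (simp add: le_antisym)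

lemma exp_le_add [simp]: "exp_le a (a + b)"
  by (simp add: exp_le_def lookup_add)

lemma exp_le_add_diff: "exp_le a b \<Longrightarrow> a + (b - a) = b"
  unfolding exp_le_def by (intro poly_mapping_eqI) (simp add: lookup_add lookup_minus)

lemma poly_mapping_eq_sum_monomials:
  fixes p :: "('k::field) mpoly"
  shows "p = (\<Sum>b\<in>Poly_Mapping.keys p. Poly_Mapping.single b (Poly_Mapping.lookup p b))"
  by (rule poly_mapping_eqI)
     (auto simp: lookup_sum lookup_single when_def in_keys_iff)

text \<open>
  A least common multiple is tested against all polynomials of the ring, so monomials alone do not
  suffice as the multiples. Multiplying by a monomial shifts all exponents, and conversely the
  quotient is obtained by shifting every term of \<open>p\<close> back.
\<close>
lemma monomial_divides_iff:
  fixes p :: "('k::field) mpoly"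
  assumes p: "p \<in> carrier (poly_ring n)"
  shows "Poly_Mapping.single a 1 divides\<^bsub>poly_ring n\<^esub> p \<longleftrightarrow> (\<forall>b\<in>Poly_Mapping.keys p. exp_le a b)"
proof
  assume "Poly_Mapping.single a 1 divides\<^bsub>poly_ring n\<^esub> p"
  then obtain c where "p = Poly_Mapping.single a 1 * c"
    by (auto simp: factor_def poly_ring_def)
  with keys_mult[of "Poly_Mapping.single a 1" c] show "\<forall>b\<in>Poly_Mapping.keys p. exp_le a b"
    by (auto split: if_splits)
next
  assume le: "\<forall>b\<in>Poly_Mapping.keys p. exp_le a b"
  define c where "c = (\<Sum>b\<in>Poly_Mapping.keys p. Poly_Mapping.single (b - a) (Poly_Mapping.lookup p b))"
  have "Poly_Mapping.single a 1 * c = (\<Sum>b\<in>Poly_Mapping.keys p. Poly_Mapping.single b (Poly_Mapping.lookup p b))"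
    unfolding c_def sum_distrib_left using le
    by (intro sum.cong) (auto simp: mult_single exp_le_add_diff)
  then have "p = Poly_Mapping.single a 1 * c"
    using poly_mapping_eq_sum_monomials[of p] by simp
  moreover have "c \<in> carrier (poly_ring n)"
  proof -
    have "Poly_Mapping.keys d \<subseteq> {1..n}" if d: "d \<in> Poly_Mapping.keys c" for d
    proof -
      obtain b where b: "b \<in> Poly_Mapping.keys p" "d = b - a"
        using d keys_sum[of "\<lambda>b. Poly_Mapping.single (b - a) (Poly_Mapping.lookup p b)" "Poly_Mapping.keys p"]
        unfolding c_def by (auto split: if_splits)
      then have "Poly_Mapping.keys d \<subseteq> Poly_Mapping.keys b"
        by (auto simp: in_keys_iff lookup_minus)
      with b p show ?thesis by (auto simp: poly_ring_def)
    qed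
    then show ?thesis by (simp add: poly_ring_def)
  qed
  ultimately show "Poly_Mapping.single a 1 divides\<^bsub>poly_ring n\<^esub> p"
    by (auto simp: factor_def poly_ring_def)
qed

lemma monomials_carrier: "monomials n \<subseteq> carrier (poly_ring n)"
  by (auto simp: monomials_def poly_ring_def)

lemma monomial_divides_monomial_iff:
  assumes "Poly_Mapping.keys b \<subseteq> {1..n}"
  shows "Poly_Mapping.single a 1 divides\<^bsub>poly_ring n\<^esub> (Poly_Mapping.single b 1 :: ('k::field) mpoly)
    \<longleftrightarrow> exp_le a b"
proof -
  have "(Poly_Mapping.single b 1 :: 'k mpoly) \<in> carrier (poly_ring n)"
    using assms by (simp add: poly_ring_def)
  then show ?thesis by (simp add: monomial_divides_iff)
qed

lemma monomial_divides_antisym: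
  fixes m m' :: "('k::field) mpoly"
  assumes "m \<in> monomials n" "m' \<in> monomials n"
    and "m divides\<^bsub>poly_ring n\<^esub> m'" "m' divides\<^bsub>poly_ring n\<^esub> m"
  shows "m = m'"
proof -
  obtain a b where "m = Poly_Mapping.single a 1" "m' = Poly_Mapping.single b 1"
    and "Poly_Mapping.keys a \<subseteq> {1..n}" "Poly_Mapping.keys b \<subseteq> {1..n}"
    using assms(1,2) by (auto simp: monomials_def)
  with assms(3,4) show ?thesis
    using exp_le_antisym[of a b] by (simp add: monomial_divides_monomial_iff)
qed


section \<open>Minimal monomial generators\<close>

text \<open>
  If \<open>M\<close> consists of monomials of the ring, this ideal contains \<open>M\<close> and hence the ideal generated by
  \<open>M\<close>, so every term of a polynomial in the generated ideal is a multiple of a member of \<open>M\<close>.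
\<close>
lemma ideal_of_monomial_multiples:
  fixes M :: "('k::field) mpoly set"
  shows "ideal {p \<in> carrier (poly_ring n :: 'k mpoly ring). \<forall>b\<in>Poly_Mapping.keys p.
           \<exists>a. Poly_Mapping.single a 1 \<in> M \<and> exp_le a b} (poly_ring n)" (is "ideal ?J _")
proof -
  interpret R: cring "poly_ring n :: 'k mpoly ring" by (rule poly_ring_cring)
  have neg: "\<ominus>\<^bsub>poly_ring n\<^esub> p = - p" if "p \<in> carrier (poly_ring n)" for p :: "'k mpoly"
    using that by (intro R.minus_equality) (auto simp: poly_ring_def in_keys_iff)
  have mult: "x \<otimes>\<^bsub>poly_ring n\<^esub> p \<in> ?J" if p: "p \<in> ?J" and x: "x \<in> carrier (poly_ring n)" for p x
  proof -
    have "\<exists>a. Poly_Mapping.single a 1 \<in> M \<and> exp_le a b" if "b \<in> Poly_Mapping.keys (p * x)" for b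
    proof -
      obtain c d where "c \<in> Poly_Mapping.keys p" "b = c + d"
        using \<open>b \<in> Poly_Mapping.keys (p * x)\<close> keys_mult[of p x] by blast
      with p show ?thesis using exp_le_trans[OF _ exp_le_add] by blast
    qed
    moreover have "x \<otimes>\<^bsub>poly_ring n\<^esub> p \<in> carrier (poly_ring n)"
      using p x by (intro R.m_closed) simp_all
    ultimately show ?thesis
      by (simp add: poly_ring_def mult.commute)
  qed
  show ?thesis
  proof (rule idealI)
    show "subgroup ?J (add_monoid (poly_ring n))"
    proof (rule R.add.subgroupI)
      show "?J \<noteq> {}" by (auto intro!: exI[of _ 0] simp: poly_ring_def)
    next
      fix p q assume pq: "p \<in> ?J" "q \<in> ?J"
      then have "p \<oplus>\<^bsub>poly_ring n\<^esub> q \<in> carrier (poly_ring n)" by (intro R.a_closed) simp_all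
      moreover have "\<exists>a. Poly_Mapping.single a 1 \<in> M \<and> exp_le a b"
        if "b \<in> Poly_Mapping.keys (p \<oplus>\<^bsub>poly_ring n\<^esub> q)" for b
      proof -
        have "b \<in> Poly_Mapping.keys p \<union> Poly_Mapping.keys q"
          using that keys_add[of p q] by (auto simp: poly_ring_def)
        with pq show ?thesis by blast
      qed
      ultimately show "p \<oplus>\<^bsub>poly_ring n\<^esub> q \<in> ?J" by blast
    next
      fix p assume p: "p \<in> ?J"
      then have "\<ominus>\<^bsub>poly_ring n\<^esub> p = - p" by (intro neg) auto
      with p show "\<ominus>\<^bsub>poly_ring n\<^esub> p \<in> ?J"
        by (auto simp: poly_ring_def in_keys_iff)
    qed auto
  next
    fix p x :: "'k mpoly" assume "p \<in> ?J" "x \<in> carrier (poly_ring n)"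
    then show "x \<otimes>\<^bsub>poly_ring n\<^esub> p \<in> ?J" by (rule mult)
    with \<open>p \<in> ?J\<close> \<open>x \<in> carrier (poly_ring n)\<close> show "p \<otimes>\<^bsub>poly_ring n\<^esub> x \<in> ?J"
      using R.m_comm by auto
  qed (rule R.ring_axioms)
qed

lemma monomial_in_genideal_iff:
  fixes M :: "('k::field) mpoly set"
  assumes M: "M \<subseteq> monomials n" and m: "m \<in> monomials n"
  shows "m \<in> Idl\<^bsub>poly_ring n\<^esub> M \<longleftrightarrow> (\<exists>m'\<in>M. m' divides\<^bsub>poly_ring n\<^esub> m)"
proof
  interpret R: cring "poly_ring n :: 'k mpoly ring" by (rule poly_ring_cring)
  let ?J = "{p \<in> carrier (poly_ring n :: 'k mpoly ring). \<forall>b\<in>Poly_Mapping.keys p.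
           \<exists>a. Poly_Mapping.single a 1 \<in> M \<and> exp_le a b}"
  assume "m \<in> Idl\<^bsub>poly_ring n\<^esub> M"
  moreover have "M \<subseteq> ?J"
  proof
    fix p assume p: "p \<in> M"
    then obtain a where "p = Poly_Mapping.single a 1" using M by (auto simp: monomials_def)
    moreover have "p \<in> carrier (poly_ring n)" using p M monomials_carrier by blast
    ultimately show "p \<in> ?J" using p exp_le_refl by auto
  qed
  ultimately have "m \<in> ?J"
    using R.genideal_minimal[OF ideal_of_monomial_multiples, of M M] by blast
  moreover obtain b where b: "m = Poly_Mapping.single b 1" "Poly_Mapping.keys b \<subseteq> {1..n}"
    using m unfolding monomials_def by blast
  ultimately obtain a where "Poly_Mapping.single a 1 \<in> M" "exp_le a b" by auto
  then show "\<exists>m'\<in>M. m' divides\<^bsub>poly_ring n\<^esub> m"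
    unfolding b(1) using monomial_divides_monomial_iff[OF b(2)] by blast
next
  interpret R: cring "poly_ring n :: 'k mpoly ring" by (rule poly_ring_cring)
  assume "\<exists>m'\<in>M. m' divides\<^bsub>poly_ring n\<^esub> m"
  then obtain m' c where m': "m' \<in> M" and c: "c \<in> carrier (poly_ring n)" "m = m' \<otimes>\<^bsub>poly_ring n\<^esub> c"
    by (auto simp: factor_def)
  have sub: "M \<subseteq> carrier (poly_ring n)" using M monomials_carrier by (rule subset_trans)
  have "m' \<in> Idl\<^bsub>poly_ring n\<^esub> M" using R.genideal_self[OF sub] m' by (rule subsetD)
  then show "m \<in> Idl\<^bsub>poly_ring n\<^esub> M"
    unfolding c(2) by (rule ideal.I_r_closed[OF R.genideal_ideal[OF sub] _ c(1)])
qed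

text \<open>
  Each \<open>m \<in> M\<close> is a multiple of some \<open>g \<in> G\<close>, which in turn is a multiple of some \<open>m' \<in> M\<close>.
  Incomparability makes \<open>m' = m\<close>, and then \<open>g\<close> is squeezed between the two.
\<close>
lemma antichain_subset_monomial_generators:
  fixes M G :: "('k::field) mpoly set"
  assumes M: "M \<subseteq> monomials n"
    and anti: "\<And>m m'. m \<in> M \<Longrightarrow> m' \<in> M \<Longrightarrow> m divides\<^bsub>poly_ring n\<^esub> m' \<Longrightarrow> m = m'"
    and G: "G \<subseteq> monomials n" and eq: "Idl\<^bsub>poly_ring n\<^esub> G = Idl\<^bsub>poly_ring n\<^esub> M"
  shows "M \<subseteq> G"
proof
  interpret R: cring "poly_ring n :: 'k mpoly ring" by (rule poly_ring_cring)
  fix m assume m: "m \<in> M"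
  have self: "X \<subseteq> Idl\<^bsub>poly_ring n\<^esub> X" if "X \<subseteq> monomials n" for X :: "'k mpoly set"
    using R.genideal_self[OF subset_trans[OF that monomials_carrier]] .
  have mG: "m \<in> Idl\<^bsub>poly_ring n\<^esub> G" using m self[OF M] eq by auto
  have mn: "m \<in> monomials n" using m M by (rule set_mp[rotated])
  obtain g where g: "g \<in> G" "g divides\<^bsub>poly_ring n\<^esub> m"
    using mG monomial_in_genideal_iff[OF G mn] by blast
  have gM: "g \<in> Idl\<^bsub>poly_ring n\<^esub> M" using g(1) self[OF G] eq by auto
  have gn: "g \<in> monomials n" using g(1) G by (rule set_mp[rotated])
  obtain m' where m': "m' \<in> M" "m' divides\<^bsub>poly_ring n\<^esub> g"
    using gM monomial_in_genideal_iff[OF M gn] by blast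
  have "m' divides\<^bsub>poly_ring n\<^esub> m"
    using m' M monomials_carrier by (intro R.divides_trans[OF m'(2) g(2)]) blast
  then have "m' = m" by (intro anti m m'(1))
  then have "m = g"
    using m'(2) g m M G by (intro monomial_divides_antisym[of m n g]) auto
  with g(1) show "m \<in> G" by simp
qed

text \<open>
  Since \<open>M\<close> lies inside every monomial generating set, it is minimal, and every minimal one
  equals \<open>M\<close>.
\<close>
lemma min_mono_gens_antichain:
  fixes M :: "('k::field) mpoly set"
  assumes M: "M \<subseteq> monomials n"
    and anti: "\<And>m m'. m \<in> M \<Longrightarrow> m' \<in> M \<Longrightarrow> m divides\<^bsub>poly_ring n\<^esub> m' \<Longrightarrow> m = m'"
  shows "min_mono_gens n (Idl\<^bsub>poly_ring n\<^esub> M) = M"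
  unfolding min_mono_gens_def
proof (rule the_equality)
  show "is_min_mono_gens n (Idl\<^bsub>poly_ring n\<^esub> M) M"
    unfolding is_min_mono_gens_def
    using M antichain_subset_monomial_generators[OF M anti] by blast
next
  fix G assume "is_min_mono_gens n (Idl\<^bsub>poly_ring n\<^esub> M) G"
  then show "G = M"
    unfolding is_min_mono_gens_def
    using antichain_subset_monomial_generators[OF M anti, of G] by blast
qed


section \<open>The lcm-lattice as a lattice of unions\<close>

definition sqfree_exp :: "nat set \<Rightarrow> (nat \<Rightarrow>\<^sub>0 nat)" where
  "sqfree_exp e = (\<Sum>i\<in>e. Poly_Mapping.single i 1)"

definition sqfree_monomial :: "nat set \<Rightarrow> ('k::field) mpoly" where
  "sqfree_monomial e = Poly_Mapping.single (sqfree_exp e) 1"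

lemma lookup_sqfree_exp: "finite e \<Longrightarrow> Poly_Mapping.lookup (sqfree_exp e) i = (if i \<in> e then 1 else 0)"
  by (auto simp: sqfree_exp_def lookup_sum lookup_single when_def)

lemma keys_sqfree_exp: "finite e \<Longrightarrow> Poly_Mapping.keys (sqfree_exp e) = e"
  by (auto simp: in_keys_iff lookup_sqfree_exp split: if_splits)

lemma prod_var_eq_sqfree_monomial:
  "finite e \<Longrightarrow> (\<Prod>i\<in>e. var i) = (sqfree_monomial e :: ('k::field) mpoly)"
  by (induction e rule: finite_induct)
     (simp_all add: sqfree_monomial_def sqfree_exp_def var_def mult_single)

lemma sqfree_monomial_in_monomials: "e \<subseteq> {1..n} \<Longrightarrow> sqfree_monomial e \<in> monomials n"
  unfolding monomials_def sqfree_monomial_def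
  using keys_sqfree_exp[of e] finite_subset[of e "{1..n}"] by auto

lemma exp_le_sqfree_iff: "finite e \<Longrightarrow> exp_le (sqfree_exp e) b \<longleftrightarrow> e \<subseteq> Poly_Mapping.keys b"
  by (auto simp: exp_le_def lookup_sqfree_exp in_keys_iff Suc_le_eq)

lemma sqfree_monomial_divides_iff:
  assumes "finite e" "p \<in> carrier (poly_ring n)"
  shows "sqfree_monomial e divides\<^bsub>poly_ring n\<^esub> (p :: ('k::field) mpoly)
    \<longleftrightarrow> (\<forall>b\<in>Poly_Mapping.keys p. e \<subseteq> Poly_Mapping.keys b)"
  using assms by (simp add: sqfree_monomial_def monomial_divides_iff exp_le_sqfree_iff)

lemma sqfree_monomial_divides_sqfree_iff:
  assumes "x \<subseteq> {1..n}" "y \<subseteq> {1..n}"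
  shows "sqfree_monomial x divides\<^bsub>poly_ring n\<^esub> (sqfree_monomial y :: ('k::field) mpoly) \<longleftrightarrow> x \<subseteq> y"
proof -
  have "finite x" "finite y" using assms finite_subset by blast+
  moreover have "(sqfree_monomial y :: 'k mpoly) \<in> carrier (poly_ring n)"
    using sqfree_monomial_in_monomials[OF assms(2)] monomials_carrier by blast
  ultimately show ?thesis
    by (subst sqfree_monomial_divides_iff) (simp_all add: sqfree_monomial_def keys_sqfree_exp)
qed

lemma inj_on_sqfree_monomial: "inj_on (sqfree_monomial :: _ \<Rightarrow> ('k::field) mpoly) (Pow {1..n})"
proof (rule inj_onI)
  fix x y assume xy: "x \<in> Pow {1..n}" "y \<in> Pow {1..n}"
    and eq: "(sqfree_monomial x :: 'k mpoly) = sqfree_monomial y"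
  have "sqfree_exp x = sqfree_exp y"
    using eq unfolding sqfree_monomial_def by (metis keys_single singleton_inject zero_neq_one)
  then show "x = y"
    using xy keys_sqfree_exp finite_subset by (metis PowD finite_atLeastAtMost)
qed

text \<open>
  A polynomial is a multiple of \<open>sqfree_monomial e\<close> when \<open>e\<close> lies in the support of each of its
  terms; for all \<open>e \<in> A\<close> together this says the same of \<open>\<Union>A\<close>.
\<close>
lemma is_lcm_sqfree_Union:
  fixes n :: nat
  assumes A: "\<Union>A \<subseteq> {1..n}"
  shows "is_lcm (poly_ring n) (sqfree_monomial ` A) (sqfree_monomial (\<Union>A) :: ('k::field) mpoly)"
proof -
  have fin: "finite (\<Union>A)" using A by (rule finite_subset) simp
  have fin_edge: "finite e" if "e \<in> A" for e
    using that by (intro finite_subset[OF _ fin]) blast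
  have "(sqfree_monomial (\<Union>A) :: 'k mpoly) \<in> carrier (poly_ring n)"
    using sqfree_monomial_in_monomials[OF A] monomials_carrier by blast
  moreover have "sqfree_monomial e divides\<^bsub>poly_ring n\<^esub> (sqfree_monomial (\<Union>A) :: 'k mpoly)"
    if "e \<in> A" for e
    using that A by (subst sqfree_monomial_divides_sqfree_iff) auto
  ultimately show ?thesis
    unfolding is_lcm_def by (simp add: sqfree_monomial_divides_iff fin fin_edge Sup_le_iff)
qed

lemma is_lcm_monomial_unique:
  fixes m m' :: "('k::field) mpoly"
  assumes "is_lcm (poly_ring n) A m" "is_lcm (poly_ring n) A m'"
    and "m \<in> monomials n" "m' \<in> monomials n"
  shows "m = m'"
  using assms unfolding is_lcm_def by (intro monomial_divides_antisym) auto

lemma min_mono_gens_edge_ideal: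
  assumes E: "\<Union>E \<subseteq> {1..n}"
    and anti: "\<And>e e'. e \<in> E \<Longrightarrow> e' \<in> E \<Longrightarrow> e \<subseteq> e' \<Longrightarrow> e = e'"
  shows "min_mono_gens n (edge_ideal n E :: ('k::field) mpoly set) = sqfree_monomial ` E"
proof -
  have fin: "finite e" if "e \<in> E" for e
    by (rule finite_subset[OF _ finite_atLeastAtMost[of 1 n]]) (use that E in blast)
  have "edge_ideal n E = Idl\<^bsub>poly_ring n\<^esub> (sqfree_monomial ` E :: 'k mpoly set)"
    unfolding edge_ideal_def using fin by (simp add: prod_var_eq_sqfree_monomial)
  moreover have "(sqfree_monomial ` E :: 'k mpoly set) \<subseteq> monomials n"
    using E sqfree_monomial_in_monomials by blast
  moreover have "(sqfree_monomial e :: 'k mpoly) = sqfree_monomial e'"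
    if e: "e \<in> E" "e' \<in> E"
      and d: "sqfree_monomial e divides\<^bsub>poly_ring n\<^esub> (sqfree_monomial e' :: 'k mpoly)" for e e'
  proof -
    have "e \<subseteq> {1..n}" "e' \<subseteq> {1..n}" using e E by blast+
    with d have "e \<subseteq> e'" by (simp add: sqfree_monomial_divides_sqfree_iff)
    with anti e show ?thesis by blast
  qed
  ultimately show ?thesis
    using min_mono_gens_antichain[of "sqfree_monomial ` E :: 'k mpoly set" n] by fastforce
qed

lemma carrier_lcm_lattice_edge_ideal:
  assumes E: "\<Union>E \<subseteq> {1..n}"
    and anti: "\<And>e e'. e \<in> E \<Longrightarrow> e' \<in> E \<Longrightarrow> e \<subseteq> e' \<Longrightarrow> e = e'"
  shows "carrier (lcm_lattice n (edge_ideal n E :: ('k::field) mpoly set))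
    = sqfree_monomial ` {\<Union>A | A. A \<subseteq> E}" (is "?C = ?U")
proof -
  have gens: "min_mono_gens n (edge_ideal n E :: 'k mpoly set) = sqfree_monomial ` E"
    by (rule min_mono_gens_edge_ideal) (fact assms)+
  have C: "?C = {m \<in> monomials n. \<exists>A\<subseteq>E. is_lcm (poly_ring n) (sqfree_monomial ` A) m}"
    unfolding lcm_lattice_def gens subset_image_iff by auto
  have sub: "\<Union>A \<subseteq> {1..n}" if "A \<subseteq> E" for A using that E by blast
  show ?thesis
  proof
    show "?C \<subseteq> ?U"
    proof
      fix m assume "m \<in> ?C"
      then obtain A where A: "A \<subseteq> E" "m \<in> monomials n"
        "is_lcm (poly_ring n) (sqfree_monomial ` A) m" unfolding C by blast
      note U = sub[OF A(1)]
      have "m = sqfree_monomial (\<Union>A)"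
        by (rule is_lcm_monomial_unique[OF A(3) is_lcm_sqfree_Union[OF U] A(2)
              sqfree_monomial_in_monomials[OF U]])
      with A(1) show "m \<in> ?U" by blast
    qed
    show "?U \<subseteq> ?C"
    proof
      fix m :: "'k mpoly" assume "m \<in> ?U"
      then obtain A where A: "A \<subseteq> E" "m = sqfree_monomial (\<Union>A)" by blast
      note U = sub[OF A(1)]
      show "m \<in> ?C"
        unfolding C A(2)
        using is_lcm_sqfree_Union[OF U] sqfree_monomial_in_monomials[OF U] A(1) by blast
    qed
  qed
qed


section \<open>Isomorphism with a Boolean lattice\<close>

text \<open>
  Joins and meets are determined by the order, so an order isomorphism onto a power set carries
  them to unions and intersections. For \<open>g = id\<close> this describes the Boolean lattice itself.
\<close>
lemma
  fixes L :: "('a, 'c) gorder_scheme" and g :: "'a \<Rightarrow> 'b set"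
  assumes eq: "eq L = (=)"
    and bij: "bij_betw g (carrier L) (Pow X)"
    and le: "\<And>x y. \<lbrakk>x \<in> carrier L; y \<in> carrier L\<rbrakk> \<Longrightarrow> x \<sqsubseteq>\<^bsub>L\<^esub> y \<longleftrightarrow> g x \<subseteq> g y"
  shows order_iso_Pow_lattice: "Lattice.lattice L"
    and order_iso_Pow_join:
      "\<lbrakk>x \<in> carrier L; y \<in> carrier L\<rbrakk> \<Longrightarrow> g (x \<squnion>\<^bsub>L\<^esub> y) = g x \<union> g y"
    and order_iso_Pow_meet:
      "\<lbrakk>x \<in> carrier L; y \<in> carrier L\<rbrakk> \<Longrightarrow> g (x \<sqinter>\<^bsub>L\<^esub> y) = g x \<inter> g y"
proof -
  have inj: "x = y" if "x \<in> carrier L" "y \<in> carrier L" "g x = g y" for x y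
    using bij that by (auto simp: bij_betw_def inj_on_def)
  have sub: "g x \<subseteq> X" if "x \<in> carrier L" for x
    using bij that by (auto simp: bij_betw_def)
  have surj: "\<exists>x\<in>carrier L. g x = B" if "B \<subseteq> X" for B
  proof -
    have "B \<in> g ` carrier L" using that bij by (simp add: bij_betw_def)
    then show ?thesis by blast
  qed
  interpret partial_order L
    using inj by unfold_locales (auto simp: eq le)
  have least: "\<exists>s. least L s (Upper L {x, y}) \<and> g s = g x \<union> g y"
    if xy: "x \<in> carrier L" "y \<in> carrier L" for x y
  proof -
    obtain s where s: "s \<in> carrier L" "g s = g x \<union> g y"
      using surj[of "g x \<union> g y"] sub xy by auto
    have upper: "u \<in> Upper L {x, y} \<longleftrightarrow> u \<in> carrier L \<and> g x \<subseteq> g u \<and> g y \<subseteq> g u" for u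
    proof -
      have "u \<in> Upper L {x, y} \<longleftrightarrow> u \<in> carrier L \<and> x \<sqsubseteq>\<^bsub>L\<^esub> u \<and> y \<sqsubseteq>\<^bsub>L\<^esub> u"
        using xy unfolding Upper_def by blast
      also have "\<dots> \<longleftrightarrow> u \<in> carrier L \<and> g x \<subseteq> g u \<and> g y \<subseteq> g u"
        using le[OF xy(1)] le[OF xy(2)] by blast
      finally show ?thesis .
    qed
    have "least L s (Upper L {x, y})"
      unfolding least_def
    proof (intro conjI ballI subsetI)
      show "s \<in> Upper L {x, y}" using s by (simp add: upper)
      fix u assume "u \<in> Upper L {x, y}"
      then have u: "u \<in> carrier L" "g x \<subseteq> g u" "g y \<subseteq> g u" by (simp_all add: upper)
      show "u \<in> carrier L" by (rule u)
      show "s \<sqsubseteq>\<^bsub>L\<^esub> u" unfolding le[OF s(1) u(1)] s(2) using u(2,3) by simp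
    qed
    with s show ?thesis by blast
  qed
  have greatest: "\<exists>s. greatest L s (Lower L {x, y}) \<and> g s = g x \<inter> g y"
    if xy: "x \<in> carrier L" "y \<in> carrier L" for x y
  proof -
    obtain s where s: "s \<in> carrier L" "g s = g x \<inter> g y"
      using surj[of "g x \<inter> g y"] sub xy by auto
    have lower: "l \<in> Lower L {x, y} \<longleftrightarrow> l \<in> carrier L \<and> g l \<subseteq> g x \<and> g l \<subseteq> g y" for l
    proof -
      have "l \<in> Lower L {x, y} \<longleftrightarrow> l \<in> carrier L \<and> l \<sqsubseteq>\<^bsub>L\<^esub> x \<and> l \<sqsubseteq>\<^bsub>L\<^esub> y"
        using xy unfolding Lower_def by blast
      also have "\<dots> \<longleftrightarrow> l \<in> carrier L \<and> g l \<subseteq> g x \<and> g l \<subseteq> g y"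
        using le[OF _ xy(1)] le[OF _ xy(2)] by blast
      finally show ?thesis .
    qed
    have "greatest L s (Lower L {x, y})"
      unfolding greatest_def
    proof (intro conjI ballI subsetI)
      show "s \<in> Lower L {x, y}" using s by (simp add: lower)
      fix l assume "l \<in> Lower L {x, y}"
      then have l: "l \<in> carrier L" "g l \<subseteq> g x" "g l \<subseteq> g y" by (simp_all add: lower)
      show "l \<in> carrier L" by (rule l)
      show "l \<sqsubseteq>\<^bsub>L\<^esub> s" unfolding le[OF l(1) s(1)] s(2) using l(2,3) by simp
    qed
    with s show ?thesis by blast
  qed
  show "Lattice.lattice L"
    using least greatest by unfold_locales blast+
  then interpret Lattice.lattice L .
  show "g (x \<squnion>\<^bsub>L\<^esub> y) = g x \<union> g y" if "x \<in> carrier L" "y \<in> carrier L"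
    using least[OF that] least_unique sup_of_two_least[OF that] by (metis join_def)
  show "g (x \<sqinter>\<^bsub>L\<^esub> y) = g x \<inter> g y" if "x \<in> carrier L" "y \<in> carrier L"
    using greatest[OF that] greatest_unique inf_of_two_greatest[OF that] by (metis meet_def)
qed

lemma lattice_boolean_lattice: "Lattice.lattice (boolean_lattice r)"
  by (rule order_iso_Pow_lattice[where g = id and X = "{1..r}"]) (auto simp: boolean_lattice_def)

lemma join_boolean_lattice:
  "\<lbrakk>x \<subseteq> {1..r}; y \<subseteq> {1..r}\<rbrakk> \<Longrightarrow> x \<squnion>\<^bsub>boolean_lattice r\<^esub> y = x \<union> y"
  using order_iso_Pow_join[where g = id and X = "{1..r}" and L = "boolean_lattice r"]
  by (simp add: boolean_lattice_def)

lemma meet_boolean_lattice: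
  "\<lbrakk>x \<subseteq> {1..r}; y \<subseteq> {1..r}\<rbrakk> \<Longrightarrow> x \<sqinter>\<^bsub>boolean_lattice r\<^esub> y = x \<inter> y"
  using order_iso_Pow_meet[where g = id and X = "{1..r}" and L = "boolean_lattice r"]
  by (simp add: boolean_lattice_def)

text \<open>
  From left to right the order is read off from the joins: \<open>x\<close> lies below \<open>y\<close> when the join of \<open>x\<close>
  and \<open>y\<close> is \<open>y\<close>.
\<close>
lemma lattice_isomorphic_boolean_iff:
  fixes L :: "('a, 'c) gorder_scheme"
  assumes eq: "eq L = (=)"
  shows "lattice_isomorphic L (boolean_lattice r) \<longleftrightarrow>
    (\<exists>g. bij_betw g (carrier L) (Pow {1..r}) \<and>
      (\<forall>x\<in>carrier L. \<forall>y\<in>carrier L. x \<sqsubseteq>\<^bsub>L\<^esub> y \<longleftrightarrow> g x \<subseteq> g y))"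
proof
  assume "lattice_isomorphic L (boolean_lattice r)"
  then obtain g where lat: "Lattice.lattice L"
    and bij: "bij_betw g (carrier L) (Pow {1..r})"
    and join: "\<And>x y. \<lbrakk>x \<in> carrier L; y \<in> carrier L\<rbrakk>
      \<Longrightarrow> g (x \<squnion>\<^bsub>L\<^esub> y) = g x \<squnion>\<^bsub>boolean_lattice r\<^esub> g y"
    unfolding lattice_isomorphic_def by (auto simp: boolean_lattice_def)
  interpret Lattice.lattice L by (rule lat)
  have "x \<sqsubseteq>\<^bsub>L\<^esub> y \<longleftrightarrow> g x \<subseteq> g y" if xy: "x \<in> carrier L" "y \<in> carrier L" for x y
  proof -
    have "g x \<subseteq> {1..r}" "g y \<subseteq> {1..r}"
      using bij xy by (auto simp: bij_betw_def)
    then have "g (x \<squnion>\<^bsub>L\<^esub> y) = g x \<union> g y"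
      using join[OF xy] join_boolean_lattice by simp
    moreover have "x \<squnion>\<^bsub>L\<^esub> y = y \<longleftrightarrow> g (x \<squnion>\<^bsub>L\<^esub> y) = g y"
      using bij xy by (metis bij_betw_def inj_on_eq_iff join_closed)
    ultimately show ?thesis
      using le_iff_meet[OF xy] by auto
  qed
  with bij show "\<exists>g. bij_betw g (carrier L) (Pow {1..r}) \<and>
      (\<forall>x\<in>carrier L. \<forall>y\<in>carrier L. x \<sqsubseteq>\<^bsub>L\<^esub> y \<longleftrightarrow> g x \<subseteq> g y)" by blast
next
  assume "\<exists>g. bij_betw g (carrier L) (Pow {1..r}) \<and>
      (\<forall>x\<in>carrier L. \<forall>y\<in>carrier L. x \<sqsubseteq>\<^bsub>L\<^esub> y \<longleftrightarrow> g x \<subseteq> g y)"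
  then obtain g where bij: "bij_betw g (carrier L) (Pow {1..r})"
    and le: "\<And>x y. \<lbrakk>x \<in> carrier L; y \<in> carrier L\<rbrakk> \<Longrightarrow> x \<sqsubseteq>\<^bsub>L\<^esub> y \<longleftrightarrow> g x \<subseteq> g y" by blast
  have "g x \<subseteq> {1..r}" if "x \<in> carrier L" for x
    using bij that by (auto simp: bij_betw_def)
  then show "lattice_isomorphic L (boolean_lattice r)"
    unfolding lattice_isomorphic_def
    using bij lattice_boolean_lattice order_iso_Pow_lattice[OF eq bij le]
    by (intro conjI exI[of _ g])
       (simp_all add: boolean_lattice_def[THEN arg_cong[where f = carrier]]
          order_iso_Pow_join[OF eq bij le] order_iso_Pow_meet[OF eq bij le]
          join_boolean_lattice meet_boolean_lattice)
qed

text \<open>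
  An edge without a vertex of its own is covered by the other edges. Its image under the isomorphism
  is an atom \<open>{i}\<close>, and the element that corresponds to \<open>X - {i}\<close> contains all the other edges,
  hence \<open>e\<close> as well, which is impossible.
\<close>
lemma union_lattice_Boolean_imp_private_vertex:
  fixes E :: "'a set set" and X :: "'b set"
  assumes ne: "{} \<notin> E"
    and anti: "\<And>e e'. e \<in> E \<Longrightarrow> e' \<in> E \<Longrightarrow> e \<subseteq> e' \<Longrightarrow> e = e'"
    and bij: "bij_betw g {\<Union>A | A. A \<subseteq> E} (Pow X)"
    and le: "\<And>A B. \<lbrakk>A \<subseteq> E; B \<subseteq> E\<rbrakk> \<Longrightarrow> \<Union>A \<subseteq> \<Union>B \<longleftrightarrow> g (\<Union>A) \<subseteq> g (\<Union>B)"
    and e: "e \<in> E"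
  shows "\<exists>v\<in>e. \<forall>e'\<in>E - {e}. v \<notin> e'"
proof (rule ccontr)
  assume "\<not> ?thesis"
  then have cover: "e \<subseteq> \<Union>(E - {e})" by blast
  have surj: "\<exists>A\<subseteq>E. g (\<Union>A) = B" if "B \<subseteq> X" for B
  proof -
    have "B \<in> g ` {\<Union>A | A. A \<subseteq> E}" using that bij by (auto simp: bij_betw_def)
    then show ?thesis by blast
  qed
  have le_edge: "e' \<subseteq> \<Union>B \<longleftrightarrow> g e' \<subseteq> g (\<Union>B)" if "e' \<in> E" "B \<subseteq> E" for e' B
    using le[of "{e'}" B] that by simp
  have "g e \<subseteq> X"
    using bij e unfolding bij_betw_def by blast
  have "g e \<noteq> {}"
  proof
    assume "g e = {}"
    then have "e \<subseteq> \<Union>{}" using le_edge[OF e, of "{}"] by simp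
    with ne e show False by simp
  qed
  then obtain i where i: "i \<in> g e" by blast
  \<comment> \<open>a union below \<open>e\<close> that contains an edge is \<open>e\<close> itself, so \<open>e\<close> is an atom and goes to a singleton\<close>
  have ge: "g e = {i}"
  proof -
    obtain A where A: "A \<subseteq> E" "g (\<Union>A) = {i}"
      using surj[of "{i}"] i \<open>g e \<subseteq> X\<close> by auto
    have "A \<noteq> {}"
    proof
      assume "A = {}"
      then have "g (\<Union>A) \<subseteq> g (\<Union>B)" if "B \<subseteq> E" for B
        using le[of A B] that by simp
      moreover obtain B where "B \<subseteq> E" "g (\<Union>B) = {}" using surj[of "{}"] by auto
      ultimately show False using A(2) by auto
    qed
    then obtain e' where e': "e' \<in> A" by blast
    have "\<Union>A \<subseteq> e" using le[of A "{e}"] A e i by simp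
    with e' A(1) have "e' = e" using anti[of e' e] e by blast
    with e' \<open>\<Union>A \<subseteq> e\<close> have "\<Union>A = e" by blast
    with A(2) show ?thesis by simp
  qed
  \<comment> \<open>\<open>\<Union>T\<close> is the largest union that does not contain \<open>e\<close>\<close>
  obtain T where T: "T \<subseteq> E" "g (\<Union>T) = X - {i}"
    using surj[of "X - {i}"] by auto
  have "e' \<subseteq> \<Union>T" if e': "e' \<in> E - {e}" for e'
  proof -
    have "\<not> e \<subseteq> e'" using anti[of e e'] e e' by blast
    then have "i \<notin> g e'" using le_edge[OF e, of "{e'}"] e' ge by simp
    moreover have "g e' \<subseteq> X" using bij e' unfolding bij_betw_def by blast
    ultimately show ?thesis using le_edge[of e' T] e' T by auto
  qed
  with cover have "e \<subseteq> \<Union>T" by blast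
  then have "g e \<subseteq> X - {i}" using le_edge[OF e T(1)] T(2) by simp
  with i show False by blast
qed

text \<open>
  The vertex that only \<open>e\<close> contains lies in \<open>\<Union>A\<close> only if \<open>e \<in> A\<close>. So \<open>A\<close> is the set of edges inside
  \<open>\<Union>A\<close>, which yields the inverse of \<open>A \<mapsto> \<Union>A\<close>.
\<close>
lemma private_vertex_imp_union_lattice_Boolean:
  fixes E :: "'a set set"
  assumes priv: "\<forall>e\<in>E. \<exists>v\<in>e. \<forall>e'\<in>E - {e}. v \<notin> e'"
    and h: "bij_betw h E X"
  shows "\<exists>g. bij_betw g {\<Union>A | A. A \<subseteq> E} (Pow X) \<and>
    (\<forall>A B. A \<subseteq> E \<longrightarrow> B \<subseteq> E \<longrightarrow> (\<Union>A \<subseteq> \<Union>B \<longleftrightarrow> g (\<Union>A) \<subseteq> g (\<Union>B)))"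
proof -
  define g where "g x = h ` {e \<in> E. e \<subseteq> x}" for x
  have edges: "{e \<in> E. e \<subseteq> \<Union>A} = A" if "A \<subseteq> E" for A
  proof
    show "{e \<in> E. e \<subseteq> \<Union>A} \<subseteq> A"
    proof
      fix e assume "e \<in> {e \<in> E. e \<subseteq> \<Union>A}"
      then have e: "e \<in> E" "e \<subseteq> \<Union>A" by auto
      with priv obtain v where v: "v \<in> e" "\<forall>e'\<in>E - {e}. v \<notin> e'" by blast
      with e(2) obtain e' where e': "e' \<in> A" "v \<in> e'" by blast
      with v(2) that have "e' = e" by blast
      with e'(1) show "e \<in> A" by simp
    qed
  qed (use that in blast)
  have g: "g (\<Union>A) = h ` A" if "A \<subseteq> E" for A
    using edges[OF that] by (simp add: g_def)
  have inj: "h ` A \<subseteq> h ` B \<longleftrightarrow> A \<subseteq> B" if "A \<subseteq> E" "B \<subseteq> E" for A B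
  proof -
    have "inj_on h E" using h by (simp add: bij_betw_def)
    then have "h a \<in> h ` B \<longleftrightarrow> a \<in> B" if "a \<in> A" for a
      using that \<open>A \<subseteq> E\<close> \<open>B \<subseteq> E\<close> by (intro inj_on_image_mem_iff[of h E]) auto
    then show ?thesis by (auto simp: image_subset_iff)
  qed
  have sub: "\<Union>A \<subseteq> \<Union>B \<longleftrightarrow> A \<subseteq> B" if "A \<subseteq> E" "B \<subseteq> E" for A B
  proof
    assume "\<Union>A \<subseteq> \<Union>B"
    then have "e \<in> {e \<in> E. e \<subseteq> \<Union>B}" if "e \<in> A" for e
      using that \<open>A \<subseteq> E\<close> by auto
    then show "A \<subseteq> B" using edges[OF \<open>B \<subseteq> E\<close>] by auto
  qed (rule Union_mono)
  have le: "\<Union>A \<subseteq> \<Union>B \<longleftrightarrow> g (\<Union>A) \<subseteq> g (\<Union>B)" if "A \<subseteq> E" "B \<subseteq> E" for A B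
    using that by (simp add: g inj sub)
  have "bij_betw g {\<Union>A | A. A \<subseteq> E} (Pow X)"
  proof (rule bij_betw_imageI)
    show "inj_on g {\<Union>A | A. A \<subseteq> E}"
    proof (rule inj_onI)
      fix x y assume "x \<in> {\<Union>A | A. A \<subseteq> E}" "y \<in> {\<Union>A | A. A \<subseteq> E}" "g x = g y"
      then obtain A B where "A \<subseteq> E" "B \<subseteq> E" "x = \<Union>A" "y = \<Union>B" "g (\<Union>A) = g (\<Union>B)" by blast
      then show "x = y" using le[of A B] le[of B A] by (simp add: subset_antisym)
    qed
    have "g ` {\<Union>A | A. A \<subseteq> E} = (\<lambda>A. g (\<Union>A)) ` Pow E"
      by (simp add: setcompr_eq_image image_image Pow_def)
    also have "\<dots> = (`) h ` Pow E" using g by (intro image_cong) auto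
    also have "\<dots> = Pow X" using h by (simp add: image_Pow_surj bij_betw_def)
    finally show "g ` {\<Union>A | A. A \<subseteq> E} = Pow X" .
  qed
  with le show ?thesis by (intro exI[of _ g] conjI allI impI)
qed

text \<open>
  The map \<open>sqfree_monomial\<close> is an order isomorphism from the family of unions onto the lcm-lattice;
  composition with it or its inverse translates the two sides.
\<close>
lemma lcm_lattice_boolean_iff_order_iso:
  assumes E: "\<Union>E \<subseteq> {1..n}"
    and anti: "\<And>e e'. e \<in> E \<Longrightarrow> e' \<in> E \<Longrightarrow> e \<subseteq> e' \<Longrightarrow> e = e'"
  shows "lattice_isomorphic (lcm_lattice n (edge_ideal n E :: ('k::field) mpoly set))
      (boolean_lattice r) \<longleftrightarrow>
    (\<exists>g. bij_betw g {\<Union>A | A. A \<subseteq> E} (Pow {1..r}) \<and>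
      (\<forall>A B. A \<subseteq> E \<longrightarrow> B \<subseteq> E \<longrightarrow> (\<Union>A \<subseteq> \<Union>B \<longleftrightarrow> g (\<Union>A) \<subseteq> g (\<Union>B))))"
    (is "_ \<longleftrightarrow> (\<exists>g. ?P g)")
proof -
  let ?L = "lcm_lattice n (edge_ideal n E :: 'k mpoly set)"
  let ?U = "{\<Union>A | A. A \<subseteq> E}"
  let ?m = "sqfree_monomial :: nat set \<Rightarrow> 'k mpoly"
  have C: "carrier ?L = ?m ` ?U" by (rule carrier_lcm_lattice_edge_ideal) (fact assms)+
  have sub: "\<Union>A \<subseteq> {1..n}" if "A \<subseteq> E" for A using that E by blast
  have inj: "inj_on ?m ?U"
    by (rule inj_on_subset[OF inj_on_sqfree_monomial]) (use sub in blast)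
  have le: "?m (\<Union>A) \<sqsubseteq>\<^bsub>?L\<^esub> ?m (\<Union>B) \<longleftrightarrow> \<Union>A \<subseteq> \<Union>B" if "A \<subseteq> E" "B \<subseteq> E" for A B
    using sub[OF that(1)] sub[OF that(2)]
    by (simp add: lcm_lattice_def sqfree_monomial_divides_sqfree_iff)
  have m: "bij_betw ?m ?U (carrier ?L)" using inj C by (simp add: bij_betw_def)
  have eq: "eq ?L = (=)" by (simp add: lcm_lattice_def)
  show ?thesis
    unfolding lattice_isomorphic_boolean_iff[OF eq]
  proof
    assume "\<exists>g. bij_betw g (carrier ?L) (Pow {1..r}) \<and>
      (\<forall>x\<in>carrier ?L. \<forall>y\<in>carrier ?L. x \<sqsubseteq>\<^bsub>?L\<^esub> y \<longleftrightarrow> g x \<subseteq> g y)"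
    then obtain g where bij: "bij_betw g (carrier ?L) (Pow {1..r})"
      and g: "\<And>x y. \<lbrakk>x \<in> carrier ?L; y \<in> carrier ?L\<rbrakk> \<Longrightarrow> x \<sqsubseteq>\<^bsub>?L\<^esub> y \<longleftrightarrow> g x \<subseteq> g y" by blast
    have "?P (g \<circ> ?m)"
    proof (intro conjI allI impI)
      show "bij_betw (g \<circ> ?m) ?U (Pow {1..r})" by (rule bij_betw_trans[OF m bij])
    next
      fix A B assume AB: "A \<subseteq> E" "B \<subseteq> E"
      then have "?m (\<Union>A) \<in> carrier ?L" "?m (\<Union>B) \<in> carrier ?L" unfolding C by blast+
      then show "\<Union>A \<subseteq> \<Union>B \<longleftrightarrow> (g \<circ> ?m) (\<Union>A) \<subseteq> (g \<circ> ?m) (\<Union>B)"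
        using g le[OF AB] by simp
    qed
    then show "\<exists>g. ?P g" by blast
  next
    assume "\<exists>g. ?P g"
    then obtain g where bij: "bij_betw g ?U (Pow {1..r})"
      and g: "\<And>A B. \<lbrakk>A \<subseteq> E; B \<subseteq> E\<rbrakk> \<Longrightarrow> \<Union>A \<subseteq> \<Union>B \<longleftrightarrow> g (\<Union>A) \<subseteq> g (\<Union>B)" by blast
    let ?h = "g \<circ> the_inv_into ?U ?m"
    have h: "?h (?m (\<Union>A)) = g (\<Union>A)" if "A \<subseteq> E" for A
      using that by (simp add: the_inv_into_f_f[OF inj] exI[of _ A])
    have "bij_betw ?h (carrier ?L) (Pow {1..r})"
      by (rule bij_betw_trans[OF bij_betw_the_inv_into[OF m] bij])
    moreover have "x \<sqsubseteq>\<^bsub>?L\<^esub> y \<longleftrightarrow> ?h x \<subseteq> ?h y" if xy: "x \<in> carrier ?L" "y \<in> carrier ?L" for x y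
    proof -
      obtain A B where AB: "A \<subseteq> E" "B \<subseteq> E" "x = ?m (\<Union>A)" "y = ?m (\<Union>B)"
        using xy unfolding C by blast
      show ?thesis
        unfolding AB(3,4) h[OF AB(1)] h[OF AB(2)] le[OF AB(1,2)] by (rule g[OF AB(1,2)])
    qed
    ultimately show "\<exists>g. bij_betw g (carrier ?L) (Pow {1..r}) \<and>
      (\<forall>x\<in>carrier ?L. \<forall>y\<in>carrier ?L. x \<sqsubseteq>\<^bsub>?L\<^esub> y \<longleftrightarrow> g x \<subseteq> g y)" by blast
  qed
qed

theorem theorem3p5:
  fixes n k :: nat and E :: "nat set set"
  assumes "k \<ge> 1" and "uniform_hypergraph k n E"
  shows "(\<exists>r. lattice_isomorphic (lcm_lattice n (edge_ideal n E :: 'k::field mpoly set))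
                                 (boolean_lattice r))
         \<longleftrightarrow> (\<forall>e\<in>E. \<exists>v\<in>e. \<forall>e'\<in>E - {e}. v \<notin> e')"
proof -
  have edge: "e \<subseteq> {1..n}" "card e = k" if "e \<in> E" for e
    using assms(2) that unfolding uniform_hypergraph_def by blast+
  have E: "\<Union>E \<subseteq> {1..n}" using edge(1) by blast
  have anti: "e = e'" if "e \<in> E" "e' \<in> E" "e \<subseteq> e'" for e e'
  proof (rule card_subset_eq)
    show "finite e'" by (rule finite_subset[OF edge(1)[OF that(2)]]) simp
    show "card e = card e'" using edge(2) that by simp
  qed (fact that(3))
  have ne: "{} \<notin> E" using edge(2)[of "{}"] assms(1) by auto
  have iso: "lattice_isomorphic (lcm_lattice n (edge_ideal n E :: 'k mpoly set))
      (boolean_lattice r) \<longleftrightarrow>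
    (\<exists>g. bij_betw g {\<Union>A | A. A \<subseteq> E} (Pow {1..r}) \<and>
      (\<forall>A B. A \<subseteq> E \<longrightarrow> B \<subseteq> E \<longrightarrow> (\<Union>A \<subseteq> \<Union>B \<longleftrightarrow> g (\<Union>A) \<subseteq> g (\<Union>B))))" for r
    by (rule lcm_lattice_boolean_iff_order_iso) (fact E, fact anti)
  show ?thesis
    unfolding iso
  proof
    assume "\<exists>(r::nat) g. bij_betw g {\<Union>A | A. A \<subseteq> E} (Pow {1..r}) \<and>
      (\<forall>A B. A \<subseteq> E \<longrightarrow> B \<subseteq> E \<longrightarrow> (\<Union>A \<subseteq> \<Union>B \<longleftrightarrow> g (\<Union>A) \<subseteq> g (\<Union>B)))"
    then obtain r :: nat and g where g: "bij_betw g {\<Union>A | A. A \<subseteq> E} (Pow {1..r})"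
      "\<forall>A B. A \<subseteq> E \<longrightarrow> B \<subseteq> E \<longrightarrow> (\<Union>A \<subseteq> \<Union>B \<longleftrightarrow> g (\<Union>A) \<subseteq> g (\<Union>B))"
      by blast
    have le: "\<Union>A \<subseteq> \<Union>B \<longleftrightarrow> g (\<Union>A) \<subseteq> g (\<Union>B)" if "A \<subseteq> E" "B \<subseteq> E" for A B
      using g(2) that by simp
    show "\<forall>e\<in>E. \<exists>v\<in>e. \<forall>e'\<in>E - {e}. v \<notin> e'"
    proof
      fix e assume e: "e \<in> E"
      show "\<exists>v\<in>e. \<forall>e'\<in>E - {e}. v \<notin> e'"
        by (rule union_lattice_Boolean_imp_private_vertex)
           (fact ne, fact anti, fact g(1), fact le, fact e)
    qed
  next
    assume priv: "\<forall>e\<in>E. \<exists>v\<in>e. \<forall>e'\<in>E - {e}. v \<notin> e'"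
    have "finite E" by (rule finite_UnionD[OF finite_subset[OF E]]) simp
    then obtain h where "bij_betw h E {1..card E}"
      using finite_same_card_bij[of E "{1..card E}"] by auto
    from private_vertex_imp_union_lattice_Boolean[OF priv this]
    show "\<exists>(r::nat) g. bij_betw g {\<Union>A | A. A \<subseteq> E} (Pow {1..r}) \<and>
      (\<forall>A B. A \<subseteq> E \<longrightarrow> B \<subseteq> E \<longrightarrow> (\<Union>A \<subseteq> \<Union>B \<longleftrightarrow> g (\<Union>A) \<subseteq> g (\<Union>B)))"
      by (rule exI[of _ "card E"])
  qed
qed

end
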